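(* Let $H_{28}$ be the simply connected Lie group with Lie algebra $\mathfrak h_{28}$. For $s_0,s_2,s_5,s_9>0$ and $s_1,s_3,s_4,s_6,s_7,s_8\in\mathbb R$ let $$\sigma=\begin{pmatrix}1&0&0&0&0&0\\0&1&0&0&0&0\\0&0&s_0&0&0&0\\0&0&s_1&s_2&0&0\\0&0&s_3&s_4&s_5&0\\0&0&s_6&s_7&s_8&s_9\end{pmatrix}$$ and let $g_\sigma=\sigma^T\sigma$ be the corresponding left-invariant metric on $H_{28}$. Define $$A=\begin{pmatrix}a&b&\alpha\\c&\beta&b\\\gamma&c&a\end{pmatrix},$$ where $a=s_5^2s_6+s_3s_5s_8-(s_1s_2+s_3s_4)s_9$, $b=s_5^2s_7+s_4s_5s_8-(s_2^2+s_4^2+s_3s_5)s_9$, $c=s_4s_5s_6+s_3s_5s_7-(s_0^2+s_1^2+s_3^2)s_9$, $\alpha=2s_5^2s_8-2s_4s_5s_9$, $\beta=2s_4s_5s_7-2(s_1s_2+s_3s_4)s_9$, $\gamma=2s_3s_5s_6$. Then $i_{\mathfrak s}(H_{28},g_\sigma)=3-\operatorname{rank}A$.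
   Context: $\mathfrak h_{28}$ is the 6-dimensional real Lie algebra with basis $e_1,\dots,e_6$ and nonzero brackets (up to skew-symmetry) $[e_1,e_2]=-e_3$, $[e_1,e_3]=-e_4$, $[e_1,e_4]=-e_5$, $[e_1,e_5]=-e_6$. The metric $g_\sigma$ is the left-invariant metric whose inner product on $\mathfrak h_{28}$ is $g_\sigma(e_i,e_j)=(\sigma^T\sigma)_{ij}$. For a left-invariant metric $g$ on this group the isotropy group of the isometry group is discrete, so every Killing field is right-invariant. For $X\in\mathfrak h$ let $X^*$ be the right-invariant field with $X^*_e=X_e$. The distribution of symmetry $\mathfrak s$ is the left-invariant distribution with $\mathfrak s_e=\{X_e: X\in\mathfrak h,\ (\nabla X^* )_e=0\}$, identified with a subspace $\mathfrak s\subset\mathfrak h$; equivalently, $Y\in\mathfrak s$ if and only if $g([X,Y],Z)+g([X,Z],Y)+g([Y,Z],X)=0$ for all $X,Z\in\mathfrak h$. The index of symmetry is $i_{\mathfrak s}(H,g)=\dim\mathfrak s$. *)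

theory Defs
  imports "HOL-Analysis.Analysis"
begin

section \<open>Vectors with six components\<close>

lemma exhaust_6:
  fixes x :: 6
  shows "x = 1 \<or> x = 2 \<or> x = 3 \<or> x = 4 \<or> x = 5 \<or> x = 6"
proof (induct x)
  case (of_int z)
  then have "0 \<le> z" "z < 6" by simp_all
  then have "z = 0 \<or> z = 1 \<or> z = 2 \<or> z = 3 \<or> z = 4 \<or> z = 5" by arith
  then show ?case by auto
qed

lemma forall_6:
  "(\<forall>i::6. P i) \<longleftrightarrow> P 1 \<and> P 2 \<and> P 3 \<and> P 4 \<and> P 5 \<and> P 6"
  by (metis exhaust_6)

lemma UNIV_6: "UNIV = {1, 2, 3, 4, 5, 6 :: 6}"
  using exhaust_6 by auto

lemma sum_6: "sum f (UNIV::6 set) = f 1 + f 2 + f 3 + f 4 + f 5 + f 6"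
  unfolding UNIV_6 by (simp add: ac_simps)

lemma vector_6 [simp]:
  "(vector [a,b,c,d,e,f] :: 'a::zero^6) $ 1 = a"
  "(vector [a,b,c,d,e,f] :: 'a::zero^6) $ 2 = b"
  "(vector [a,b,c,d,e,f] :: 'a::zero^6) $ 3 = c"
  "(vector [a,b,c,d,e,f] :: 'a::zero^6) $ 4 = d"
  "(vector [a,b,c,d,e,f] :: 'a::zero^6) $ 5 = e"
  "(vector [a,b,c,d,e,f] :: 'a::zero^6) $ 6 = f"
  by (simp_all add: vector_def)

lemma has_derivative_vector_6:
  fixes f1 f2 f3 f4 f5 f6 :: "'a::real_normed_vector \<Rightarrow> real"
  assumes "(f1 has_derivative d1) F" "(f2 has_derivative d2) F" "(f3 has_derivative d3) F"
    "(f4 has_derivative d4) F" "(f5 has_derivative d5) F" "(f6 has_derivative d6) F"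
  shows "((\<lambda>x. vector [f1 x, f2 x, f3 x, f4 x, f5 x, f6 x] :: real^6) has_derivative
    (\<lambda>h. vector [d1 h, d2 h, d3 h, d4 h, d5 h, d6 h])) F"
proof -
  have *: "(vector [a,b,c,d,e,f] :: real^6) = a *\<^sub>R axis 1 1 + b *\<^sub>R axis 2 1 + c *\<^sub>R axis 3 1
      + d *\<^sub>R axis 4 1 + e *\<^sub>R axis 5 1 + f *\<^sub>R axis 6 1" for a b c d e f
    by (simp add: vec_eq_iff forall_6 axis_def)
  show ?thesis
    unfolding * by (intro has_derivative_add has_derivative_scaleR_left assms)
qed

lemma has_derivative_vec_nth: "((\<lambda>x::real^'n. x $ i) has_derivative (\<lambda>h. h $ i)) F"
  by (rule bounded_linear_imp_has_derivative) (rule bounded_linear_vec_nth)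

section \<open>Riemannian geometry in a global chart\<close>

text \<open>
  The manifold is the space \<^typ>\<open>real^'n\<close> itself, with its standard global chart.  A vector field is
  a map \<^typ>\<open>real^'n \<Rightarrow> real^'n\<close> and a Riemannian metric is a map \<^typ>\<open>real^'n \<Rightarrow> real^'n^'n\<close> giving
  its coefficients \<open>g p $ i $ j\<close> in the coordinate frame at the point \<open>p\<close>.
\<close>

definition lie_bracket ::
    "(real^'n \<Rightarrow> real^'n) \<Rightarrow> (real^'n \<Rightarrow> real^'n) \<Rightarrow> real^'n \<Rightarrow> real^'n" where
  "lie_bracket V W p = frechet_derivative W (at p) (V p) - frechet_derivative V (at p) (W p)"

definition metric_partial :: "(real^'n \<Rightarrow> real^'n^'n) \<Rightarrow> real^'n \<Rightarrow> 'n \<Rightarrow> 'n \<Rightarrow> 'n \<Rightarrow> real" where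
  "metric_partial g p k i j = frechet_derivative (\<lambda>q. g q $ i $ j) (at p) (axis k 1)"

text \<open>\<open>christoffel g p k i j\<close> is the Christoffel symbol with upper index \<open>k\<close>.\<close>

definition christoffel :: "(real^'n \<Rightarrow> real^'n^'n) \<Rightarrow> real^'n \<Rightarrow> 'n \<Rightarrow> 'n \<Rightarrow> 'n \<Rightarrow> real" where
  "christoffel g p k i j = (1/2) * (\<Sum>l\<in>UNIV. matrix_inv (g p) $ k $ l *
     (metric_partial g p i j l + metric_partial g p j i l - metric_partial g p l i j))"

text \<open>\<open>levi_civita g v Y p\<close> is the covariant derivative at \<open>p\<close> of the field \<open>Y\<close> in the direction of
  the tangent vector \<open>v\<close> at \<open>p\<close>.\<close>

definition levi_civita ::
    "(real^'n \<Rightarrow> real^'n^'n) \<Rightarrow> real^'n \<Rightarrow> (real^'n \<Rightarrow> real^'n) \<Rightarrow> real^'n \<Rightarrow> real^'n" where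
  "levi_civita g v Y p = frechet_derivative Y (at p) v +
     (\<chi> k. \<Sum>i\<in>UNIV. \<Sum>j\<in>UNIV. christoffel g p k i j * v $ i * Y p $ j)"

section \<open>The simply connected group \<open>H\<^sub>2\<^sub>8\<close>\<close>

text \<open>
  The Lie algebra is the semidirect sum of the line spanned by \<open>e\<^sub>1\<close> and the abelian ideal spanned by
  \<open>e\<^sub>2, \<dots>, e\<^sub>6\<close>, on which \<open>e\<^sub>1\<close> acts by the nilpotent map \<open>D\<close> with \<open>D e\<^sub>j = - e\<^sub>j\<^sub>+\<^sub>1\<close>.
  The simply connected group is therefore the semidirect product of two vector groups with
  \<open>(s, v) (t, w) = (s + t, v + exp (s D) w)\<close>, and it is modelled here by \<^typ>\<open>real^6\<close> with neutral
  element 0 and first coordinate \<open>s\<close>.  The tangent space at 0 is the Lie algebra, the standard basis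
  vectors being \<open>e\<^sub>1, \<dots>, e\<^sub>6\<close>.
\<close>

definition h28_mult :: "real^6 \<Rightarrow> real^6 \<Rightarrow> real^6" where
  "h28_mult x y = vector [
     x$1 + y$1,
     x$2 + y$2,
     x$3 + y$3 - x$1 * y$2,
     x$4 + y$4 - x$1 * y$3 + (x$1)^2 / 2 * y$2,
     x$5 + y$5 - x$1 * y$4 + (x$1)^2 / 2 * y$3 - (x$1)^3 / 6 * y$2,
     x$6 + y$6 - x$1 * y$5 + (x$1)^2 / 2 * y$4 - (x$1)^3 / 6 * y$3 + (x$1)^4 / 24 * y$2]"

definition h28_inv :: "real^6 \<Rightarrow> real^6" where
  "h28_inv x = vector [
     - x$1,
     - x$2,
     - (x$3 + x$1 * x$2),
     - (x$4 + x$1 * x$3 + (x$1)^2 / 2 * x$2),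
     - (x$5 + x$1 * x$4 + (x$1)^2 / 2 * x$3 + (x$1)^3 / 6 * x$2),
     - (x$6 + x$1 * x$5 + (x$1)^2 / 2 * x$4 + (x$1)^3 / 6 * x$3 + (x$1)^4 / 24 * x$2)]"

definition h28_bracket :: "real^6 \<Rightarrow> real^6 \<Rightarrow> real^6" where
  "h28_bracket X Y = vector [
     0,
     0,
     - (X$1 * Y$2 - X$2 * Y$1),
     - (X$1 * Y$3 - X$3 * Y$1),
     - (X$1 * Y$4 - X$4 * Y$1),
     - (X$1 * Y$5 - X$5 * Y$1)]"

definition left_invariant_field :: "real^6 \<Rightarrow> real^6 \<Rightarrow> real^6" where
  "left_invariant_field X p = frechet_derivative (\<lambda>q. h28_mult p q) (at 0) X"

definition right_invariant_field :: "real^6 \<Rightarrow> real^6 \<Rightarrow> real^6" where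
  "right_invariant_field X p = frechet_derivative (\<lambda>q. h28_mult q p) (at 0) X"

text \<open>The left-invariant metric whose Gram matrix on \<open>e\<^sub>1, \<dots>, e\<^sub>6\<close> at the neutral element is \<open>G\<close>:
  tangent vectors at \<open>p\<close> are moved to the neutral element by the left translation by \<open>p\<close> inverse.\<close>

definition left_invariant_metric :: "real^6^6 \<Rightarrow> real^6 \<Rightarrow> real^6^6" where
  "left_invariant_metric G p =
     (let L = frechet_derivative (\<lambda>q. h28_mult (h28_inv p) q) (at p)
      in \<chi> i j. L (axis i 1) \<bullet> (G *v L (axis j 1)))"

text \<open>The Killing fields used here are the right-invariant fields: the isotropy groups of the left-invariant
  metrics on this group are discrete, so that there are no others.\<close>

definition symmetry_distribution :: "(real^6 \<Rightarrow> real^6^6) \<Rightarrow> real^6 \<Rightarrow> (real^6) set" where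
  "symmetry_distribution g p = frechet_derivative (\<lambda>q. h28_mult p q) (at 0) `
     {right_invariant_field X 0 | X. \<forall>v. levi_civita g v (right_invariant_field X) 0 = 0}"

definition index_of_symmetry :: "(real^6 \<Rightarrow> real^6^6) \<Rightarrow> nat" where
  "index_of_symmetry g = dim (symmetry_distribution g 0)"

section \<open>Validation of the model\<close>

lemma h28_mult_assoc: "h28_mult (h28_mult x y) z = h28_mult x (h28_mult y z)"
  unfolding h28_mult_def vec_eq_iff forall_6
  by (simp add: field_simps power2_eq_square power3_eq_cube power4_eq_xxxx)

lemma h28_mult_0 [simp]: "h28_mult 0 x = x" "h28_mult x 0 = x"
  by (simp_all add: h28_mult_def vec_eq_iff forall_6)

lemma h28_mult_inv: "h28_mult (h28_inv x) x = 0" "h28_mult x (h28_inv x) = 0"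
  by (simp_all add: h28_mult_def h28_inv_def vec_eq_iff forall_6 field_simps power2_eq_square
      power3_eq_cube power4_eq_xxxx)

lemma has_derivative_h28_mult_left:
  "((\<lambda>q. h28_mult p q) has_derivative (\<lambda>h. h28_mult p h - p)) (at x)"
proof -
  have *: "(\<lambda>h. h28_mult p h - p) = (\<lambda>h. vector [
     h$1,
     h$2,
     h$3 - p$1 * h$2,
     h$4 - p$1 * h$3 + (p$1)^2 / 2 * h$2,
     h$5 - p$1 * h$4 + (p$1)^2 / 2 * h$3 - (p$1)^3 / 6 * h$2,
     h$6 - p$1 * h$5 + (p$1)^2 / 2 * h$4 - (p$1)^3 / 6 * h$3 + (p$1)^4 / 24 * h$2])"
    by (simp add: fun_eq_iff h28_mult_def vec_eq_iff forall_6)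
  show ?thesis
    unfolding * unfolding h28_mult_def
    by (intro has_derivative_vector_6)
      (auto intro!: derivative_eq_intros has_derivative_vec_nth simp: mult_ac)
qed

lemma left_invariant_field_eq: "left_invariant_field X p = h28_mult p X - p"
  unfolding left_invariant_field_def
  by (subst frechet_derivative_at[OF has_derivative_h28_mult_left, symmetric]) simp

lemma left_invariant_field_invariant:
  "frechet_derivative (\<lambda>q. h28_mult x q) (at p) (left_invariant_field X p)
     = left_invariant_field X (h28_mult x p)"
  unfolding left_invariant_field_eq frechet_derivative_at[OF has_derivative_h28_mult_left, symmetric]
  unfolding h28_mult_def vec_eq_iff forall_6
  by (simp add: field_simps power2_eq_square power3_eq_cube power4_eq_xxxx)

lemma right_invariant_field_eq:
  "right_invariant_field X p =
     vector [X$1, X$2, X$3 - X$1 * p$2, X$4 - X$1 * p$3, X$5 - X$1 * p$4, X$6 - X$1 * p$5]"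
proof -
  have "((\<lambda>q. h28_mult q p) has_derivative
    (\<lambda>X. vector [X$1, X$2, X$3 - X$1 * p$2, X$4 - X$1 * p$3, X$5 - X$1 * p$4, X$6 - X$1 * p$5])) (at 0)"
    unfolding h28_mult_def
    by (intro has_derivative_vector_6)
      (auto intro!: derivative_eq_intros has_derivative_vec_nth simp: mult_ac)
  from frechet_derivative_at[OF this, symmetric] show ?thesis
    by (simp add: right_invariant_field_def)
qed

lemma left_invariant_metric_left_invariant_field:
  "left_invariant_field X p \<bullet> (left_invariant_metric G p *v left_invariant_field Y p) = X \<bullet> (G *v Y)"
proof -
  define L where "L = (\<lambda>h. h28_mult (h28_inv p) h - h28_inv p)"
  have L: "frechet_derivative (\<lambda>q. h28_mult (h28_inv p) q) (at p) = L"
    unfolding L_def frechet_derivative_at[OF has_derivative_h28_mult_left, symmetric] ..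
  have lin: "linear L"
    using has_derivative_linear[OF has_derivative_h28_mult_left] by (simp add: L_def)
  have *: "L (left_invariant_field X p) = X" for X
    using left_invariant_field_invariant[of "h28_inv p" p X]
    by (simp add: L h28_mult_inv left_invariant_field_eq)
  have ex: "L v = (\<Sum>i\<in>UNIV. v $ i *\<^sub>R L (axis i 1))" for v
    by (metis (no_types, lifting) basis_expansion lin linear_cmul linear_sum scalar_mult_eq_scaleR
        sum.cong)
  have "v \<bullet> (left_invariant_metric G p *v w) = L v \<bullet> (G *v L w)" for v w
  proof -
    have "L v \<bullet> (G *v L w) = (\<Sum>i\<in>UNIV. v $ i * (L (axis i 1) \<bullet> (G *v L w)))"
      by (subst ex) (simp add: inner_sum_left)
    also have "\<dots> = (\<Sum>i\<in>UNIV. v $ i * (\<Sum>j\<in>UNIV. w $ j * (L (axis i 1) \<bullet> (G *v L (axis j 1)))))"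
      by (subst ex[of w]) (simp add: linear_sum[OF matrix_vector_mul_linear]
          matrix_vector_mult_scaleR inner_sum_right)
    finally show ?thesis
      by (simp add: left_invariant_metric_def L inner_vec_def[of v] matrix_vector_mult_def[of "vec_lambda _"] mult.commute)
  qed
  then show ?thesis by (simp add: *)
qed

lemma lie_bracket_left_invariant_field:
  "lie_bracket (left_invariant_field X) (left_invariant_field Y) =
     left_invariant_field (h28_bracket X Y)"
proof
  fix p
  have "(left_invariant_field Z has_derivative (\<lambda>h. vector [
     0,
     0,
     - h$1 * Z$2,
     - h$1 * Z$3 + p$1 * h$1 * Z$2,
     - h$1 * Z$4 + p$1 * h$1 * Z$3 - (p$1)^2 / 2 * h$1 * Z$2,
     - h$1 * Z$5 + p$1 * h$1 * Z$4 - (p$1)^2 / 2 * h$1 * Z$3 + (p$1)^3 / 6 * h$1 * Z$2])) (at p)" for Z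
  proof -
    have *: "left_invariant_field Z = (\<lambda>p. vector [
     Z$1,
     Z$2,
     Z$3 - p$1 * Z$2,
     Z$4 - p$1 * Z$3 + (p$1)^2 / 2 * Z$2,
     Z$5 - p$1 * Z$4 + (p$1)^2 / 2 * Z$3 - (p$1)^3 / 6 * Z$2,
     Z$6 - p$1 * Z$5 + (p$1)^2 / 2 * Z$4 - (p$1)^3 / 6 * Z$3 + (p$1)^4 / 24 * Z$2])"
      by (simp add: fun_eq_iff left_invariant_field_eq h28_mult_def vec_eq_iff forall_6)
    show ?thesis
      unfolding *
      by (intro has_derivative_vector_6)
        (auto intro!: derivative_eq_intros has_derivative_vec_nth simp: field_simps)
  qed
  note d = frechet_derivative_at[OF this, symmetric]
  show "lie_bracket (left_invariant_field X) (left_invariant_field Y) p =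
     left_invariant_field (h28_bracket X Y) p"
    unfolding lie_bracket_def d
    unfolding left_invariant_field_eq h28_mult_def h28_bracket_def vec_eq_iff forall_6
    by (simp add: field_simps power2_eq_square power3_eq_cube power4_eq_xxxx)
qed

lemma h28_bracket_axis:
  "h28_bracket (axis 1 1) (axis 2 1) = - axis 3 1"
  "h28_bracket (axis 1 1) (axis 3 1) = - axis 4 1"
  "h28_bracket (axis 1 1) (axis 4 1) = - axis 5 1"
  "h28_bracket (axis 1 1) (axis 5 1) = - axis 6 1"
  "h28_bracket (axis 1 1) (axis 6 1) = 0"
  "i \<noteq> 1 \<Longrightarrow> j \<noteq> 1 \<Longrightarrow> h28_bracket (axis i 1) (axis j 1) = 0"
  "h28_bracket X Y = - h28_bracket Y X"
  by (simp_all add: h28_bracket_def vec_eq_iff forall_6 axis_def)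

end

theory Submission
  imports Defs
begin

text \<open>
  Koszul's formula turns the vanishing of \<open>\<nabla>X\<^sup>*\<close> at the neutral element into a purely algebraic
  condition on \<open>X\<close>, the vanishing of \<open>g([Y,X],Z) + g([Y,Z],X) + g([X,Z],Y)\<close> for all \<open>Y, Z\<close>
  (\<open>koszul_right_invariant_field\<close>).  In a general chart this needs the derivatives of the metric
  coefficients; here they only depend on the first coordinate, and at the neutral element their
  derivative is the symmetric form \<open>shift_form\<close>, because the differentials of the left
  translations are exponentials of multiples of the nilpotent map \<open>shift = - ad e\<^sub>1\<close>.

  Taking \<open>e\<^sub>5, e\<^sub>6\<close> for \<open>Y, Z\<close> forces \<open>X\<close> into the abelian ideal spanned by \<open>e\<^sub>2, \<dots>, e\<^sub>6\<close>, and
  then the condition says that \<open>X\<close> lies in the kernel of the symmetric form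
  \<open>g(shift X, Z) + g(X, shift Z)\<close> on this ideal (\<open>symmetry_condition_iff\<close>).  This is a linear system
  of five equations, indexed by \<open>Z = e\<^sub>2, \<dots>, e\<^sub>6\<close>, in the five unknowns \<open>X\<^sub>2, \<dots>, X\<^sub>6\<close>.  The
  equation for \<open>e\<^sub>6\<close> determines \<open>X\<^sub>5\<close> and the one for \<open>e\<^sub>5\<close> determines \<open>X\<^sub>6\<close>, since \<open>\<sigma>\<close> is triangular
  with nonzero diagonal.  Eliminating both unknowns from the other three equations, that is, forming a
  Schur complement, leaves the matrix \<open>A\<close> up to the factor \<open>- 1 / s\<^sub>9\<close> and the order of the rows
  (\<open>kernel_equations\<close>).  So the space in question is isomorphic to the kernel of \<open>A\<close>, and rank-nullity
  gives the dimension.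
\<close>

section \<open>Inverse matrices, kernels and Gram matrices\<close>

lemma matrix_inv_right:
  fixes G :: "'a::semiring_1^'n^'n"
  assumes "invertible G"
  shows "G ** matrix_inv G = mat 1"
  using someI_ex[OF assms[unfolded invertible_def]] by (simp add: matrix_inv_def)

lemma dim_kernel_plus_rank:
  fixes A :: "real^'n^'m"
  shows "dim {x. A *v x = 0} + rank A = CARD('n)"
proof -
  have "A *v x = 0 \<longleftrightarrow> (\<forall>y\<in>span (rows A). orthogonal y x)" for x
  proof
    assume "A *v x = 0"
    then show "\<forall>y\<in>span (rows A). orthogonal y x"
      by (metis orthogonal_commute orthogonal_nullspace_rowspace span_vec_eq)
  next
    assume "\<forall>y\<in>span (rows A). orthogonal y x"
    then have "row i A \<bullet> x = 0" for i
      by (auto simp: orthogonal_def rows_def intro!: span_base)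
    then show "A *v x = 0"
      by (simp add: vec_eq_iff matrix_vector_mul_component row_def vec_nth_inverse)
  qed
  then have *: "{x. A *v x = 0} = {x \<in> UNIV. \<forall>y\<in>span (rows A). orthogonal y x}"
    by simp
  show ?thesis
    using dim_subspace_orthogonal_to_vectors[of "span (rows A)" UNIV]
    by (simp add: * row_rank_def)
qed

lemma gram_inner:
  fixes \<sigma> :: "real^'n^'m"
  shows "x \<bullet> ((transpose \<sigma> ** \<sigma>) *v y) = (\<sigma> *v x) \<bullet> (\<sigma> *v y)"
  by (metis dot_lmul_matrix inner_commute matrix_vector_mul_assoc transpose_matrix_vector)

lemma invertible_gram:
  fixes \<sigma> :: "real^'n^'m"
  assumes "\<And>x. \<sigma> *v x = 0 \<Longrightarrow> x = 0"
  shows "invertible (transpose \<sigma> ** \<sigma>)"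
proof -
  have "x = 0" if "(transpose \<sigma> ** \<sigma>) *v x = 0" for x
    using gram_inner[of x \<sigma> x] that assms[of x] by simp
  then show ?thesis
    using matrix_left_invertible_ker[of "transpose \<sigma> ** \<sigma>"] invertible_left_inverse by blast
qed

lemma bilinear_expansion:
  fixes f :: "real^'n \<Rightarrow> real^'m \<Rightarrow> real"
  assumes "bilinear f"
  shows "(\<Sum>i\<in>UNIV. x$i * f (axis i 1) v) = f x v"
    and "(\<Sum>j\<in>UNIV. y$j * f u (axis j 1)) = f u y"
proof -
  have "linear (\<lambda>x. f x v)" "linear (f u)"
    using assms by (simp_all add: bilinear_def)
  from linear_sum[OF this(1), of "\<lambda>i. x$i *\<^sub>R axis i 1" UNIV]
    linear_sum[OF this(2), of "\<lambda>i. y$i *\<^sub>R axis i 1" UNIV]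
  show "(\<Sum>i\<in>UNIV. x$i * f (axis i 1) v) = f x v" "(\<Sum>j\<in>UNIV. y$j * f u (axis j 1)) = f u y"
    using basis_expansion[of x] basis_expansion[of y]
    by (simp_all add: linear_cmul[OF \<open>linear (\<lambda>x. f x v)\<close>] linear_cmul[OF \<open>linear (f u)\<close>]
        scalar_mult_eq_scaleR)
qed

section \<open>The metric to first order at the neutral element\<close>

text \<open>On the Lie algebra this is \<open>- ad e\<^sub>1\<close>; see \<open>h28_bracket_shift\<close>.\<close>

definition shift :: "real^6 \<Rightarrow> real^6" where
  "shift v = vector [0, 0, v$2, v$3, v$4, v$5]"

lemma linear_shift: "linear shift"
  by (rule linearI) (simp_all add: shift_def vec_eq_iff forall_6)

lemmas shift_linear = linear_add[OF linear_shift] linear_cmul[OF linear_shift]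

lemma h28_bracket_shift: "h28_bracket X Y = Y$1 *\<^sub>R shift X - X$1 *\<^sub>R shift Y"
  by (simp add: h28_bracket_def shift_def vec_eq_iff forall_6)

text \<open>The Lie derivative of the inner product \<open>G\<close> along the flow of \<open>shift\<close>.\<close>

definition shift_form :: "real^6^6 \<Rightarrow> real^6 \<Rightarrow> real^6 \<Rightarrow> real" where
  "shift_form G u v = shift u \<bullet> (G *v v) + u \<bullet> (G *v shift v)"

lemma bilinear_shift_form: "bilinear (shift_form G)"
  unfolding bilinear_def shift_form_def
  by (auto intro!: linearI simp: shift_linear inner_add_left inner_add_right
      matrix_vector_right_distrib matrix_vector_mult_scaleR algebra_simps)

text \<open>
  Left translation by the inverse of \<open>q\<close> acts on tangent vectors as \<open>exp (q\<^sub>1 shift)\<close>, whatever the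
  other coordinates of \<open>q\<close> are; to first order at 0 this is \<open>v + q\<^sub>1 shift v\<close>.
\<close>

lemma has_derivative_left_translation_inverse:
  "((\<lambda>q. h28_mult (h28_inv q) v - h28_inv q) has_derivative (\<lambda>h. h$1 *\<^sub>R shift v)) (at 0)"
proof -
  have 1: "(\<lambda>q. h28_mult (h28_inv q) v - h28_inv q) = (\<lambda>q. vector [
     v$1,
     v$2,
     v$3 + q$1 * v$2,
     v$4 + q$1 * v$3 + (q$1)^2 / 2 * v$2,
     v$5 + q$1 * v$4 + (q$1)^2 / 2 * v$3 + (q$1)^3 / 6 * v$2,
     v$6 + q$1 * v$5 + (q$1)^2 / 2 * v$4 + (q$1)^3 / 6 * v$3 + (q$1)^4 / 24 * v$2])"
    by (simp add: fun_eq_iff h28_mult_def h28_inv_def vec_eq_iff forall_6)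
  have 2: "(\<lambda>h::real^6. h$1 *\<^sub>R shift v) =
      (\<lambda>h. vector [0, 0, h$1 * v$2, h$1 * v$3, h$1 * v$4, h$1 * v$5])"
    by (simp add: fun_eq_iff shift_def vec_eq_iff forall_6)
  show ?thesis
    unfolding 1 2
    by (intro has_derivative_vector_6)
      (auto intro!: derivative_eq_intros has_derivative_vec_nth)
qed

lemma left_invariant_metric_nth:
  "left_invariant_metric G q $ i $ j =
     (h28_mult (h28_inv q) (axis i 1) - h28_inv q) \<bullet>
       (G *v (h28_mult (h28_inv q) (axis j 1) - h28_inv q))"
  unfolding left_invariant_metric_def
    frechet_derivative_at[OF has_derivative_h28_mult_left, symmetric]
  by simp

lemma metric_partial_left_invariant_metric:
  "metric_partial (left_invariant_metric G) 0 k i j =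
     (if k = 1 then shift_form G (axis i 1) (axis j 1) else 0)"
proof -
  let ?L = "\<lambda>v q. h28_mult (h28_inv q) v - h28_inv q"
  have L0: "?L v 0 = v" for v
    by (simp add: h28_mult_def h28_inv_def vec_eq_iff forall_6)
  have "((\<lambda>q. ?L u q \<bullet> (G *v ?L v q)) has_derivative
      (\<lambda>h. ?L u 0 \<bullet> (G *v (h$1 *\<^sub>R shift v)) + (h$1 *\<^sub>R shift u) \<bullet> (G *v ?L v 0))) (at 0)" for u v
    by (intro has_derivative_inner has_derivative_left_translation_inverse
        bounded_linear.has_derivative[OF matrix_vector_mul_bounded_linear])
  then have "((\<lambda>q. left_invariant_metric G q $ i $ j) has_derivative
      (\<lambda>h. h$1 * shift_form G (axis i 1) (axis j 1))) (at 0)"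
    unfolding left_invariant_metric_nth L0
    by (simp add: shift_form_def matrix_vector_mult_scaleR algebra_simps)
  from frechet_derivative_at[OF this, symmetric] show ?thesis
    by (simp add: metric_partial_def axis_def)
qed

lemma left_invariant_metric_0: "left_invariant_metric G 0 = G"
proof -
  have "left_invariant_metric G 0 $ i $ j = G $ i $ j" for i j
  proof -
    have "h28_mult (h28_inv 0) v - h28_inv 0 = v" for v
      by (simp add: h28_mult_def h28_inv_def vec_eq_iff forall_6)
    then show ?thesis
      by (simp add: left_invariant_metric_nth matrix_vector_mult_basis column_def inner_axis')
  qed
  then show ?thesis by (simp add: vec_eq_iff)
qed

section \<open>Covariant derivatives of right-invariant fields\<close>

text \<open>
  Only the derivative of the metric in direction \<open>e\<^sub>1\<close> is nonzero, so that each of the three terms of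
  the Christoffel symbol contracts to a single value of \<open>shift_form\<close>.
\<close>

lemma christoffel_contraction:
  "(\<Sum>i\<in>UNIV. \<Sum>j\<in>UNIV. christoffel (left_invariant_metric G) 0 k i j * v$i * X$j) =
     (1/2) * (matrix_inv G *v (\<chi> l. v$1 * shift_form G X (axis l 1) + X$1 * shift_form G v (axis l 1)
       - (if l = 1 then shift_form G v X else 0))) $ k"
proof -
  let ?B = "shift_form G"
  note expand = bilinear_expansion[OF bilinear_shift_form]
  have 1: "(\<Sum>i\<in>UNIV. \<Sum>j\<in>UNIV. (if i = 1 then ?B (axis j 1) (axis l 1) else 0) * v$i * X$j)
      = v$1 * ?B X (axis l 1)" for l
  proof -
    have "(\<Sum>i\<in>UNIV. \<Sum>j\<in>UNIV. (if i = 1 then ?B (axis j 1) (axis l 1) else 0) * v$i * X$j)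
        = (\<Sum>i\<in>UNIV. if i = 1 then v$i * (\<Sum>j\<in>UNIV. X$j * ?B (axis j 1) (axis l 1)) else 0)"
      by (intro sum.cong refl) (auto simp: sum_distrib_left mult_ac intro!: sum.cong)
    then show ?thesis by (simp add: expand)
  qed
  have 2: "(\<Sum>i\<in>UNIV. \<Sum>j\<in>UNIV. (if j = 1 then ?B (axis i 1) (axis l 1) else 0) * v$i * X$j)
      = X$1 * ?B v (axis l 1)" for l
  proof -
    have "(\<Sum>i\<in>UNIV. \<Sum>j\<in>UNIV. (if j = 1 then ?B (axis i 1) (axis l 1) else 0) * v$i * X$j)
        = (\<Sum>i\<in>UNIV. \<Sum>j\<in>UNIV. if j = 1 then X$j * (v$i * ?B (axis i 1) (axis l 1)) else 0)"
      by (intro sum.cong refl) auto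
    also have "\<dots> = X$1 * (\<Sum>i\<in>UNIV. v$i * ?B (axis i 1) (axis l 1))"
      by (simp add: sum_distrib_left)
    finally show ?thesis by (simp add: expand)
  qed
  have 3: "(\<Sum>i\<in>UNIV. \<Sum>j\<in>UNIV. (if l = 1 then ?B (axis i 1) (axis j 1) else 0) * v$i * X$j)
      = (if l = (1::6) then ?B v X else 0)" for l
  proof -
    have "(\<Sum>i\<in>UNIV. \<Sum>j\<in>UNIV. ?B (axis i 1) (axis j 1) * v$i * X$j)
        = (\<Sum>i\<in>UNIV. v$i * (\<Sum>j\<in>UNIV. X$j * ?B (axis i 1) (axis j 1)))"
      by (intro sum.cong refl) (auto simp: sum_distrib_left mult_ac intro!: sum.cong)
    then show ?thesis by (simp add: expand)
  qed
  let ?T = "\<lambda>l i j. (if i = 1 then ?B (axis j 1) (axis l 1) else 0)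
    + (if j = 1 then ?B (axis i 1) (axis l 1) else 0)
    - (if l = 1 then ?B (axis i 1) (axis j 1) else 0)"
  have "(\<Sum>i\<in>UNIV. \<Sum>j\<in>UNIV. christoffel (left_invariant_metric G) 0 k i j * v$i * X$j) =
     (\<Sum>i\<in>UNIV. \<Sum>j\<in>UNIV. \<Sum>l\<in>UNIV. (1/2) * matrix_inv G $ k $ l * (?T l i j * v$i * X$j))"
    by (simp add: christoffel_def metric_partial_left_invariant_metric left_invariant_metric_0
        sum_distrib_left sum_distrib_right mult.assoc)
  also have "\<dots> = (\<Sum>l\<in>UNIV. \<Sum>i\<in>UNIV. \<Sum>j\<in>UNIV. (1/2) * matrix_inv G $ k $ l * (?T l i j * v$i * X$j))"
    (is "_ = ?R")
  proof -
    have "(\<Sum>i\<in>UNIV. \<Sum>j\<in>UNIV. \<Sum>l\<in>UNIV. (1/2) * matrix_inv G $ k $ l * (?T l i j * v$i * X$j)) =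
       (\<Sum>i\<in>UNIV. \<Sum>l\<in>UNIV. \<Sum>j\<in>UNIV. (1/2) * matrix_inv G $ k $ l * (?T l i j * v$i * X$j))"
      by (intro sum.cong refl sum.swap)
    also have "\<dots> = ?R"
      by (rule sum.swap)
    finally show ?thesis .
  qed
  also have "\<dots> = (\<Sum>l\<in>UNIV. (1/2) * matrix_inv G $ k $ l * (\<Sum>i\<in>UNIV. \<Sum>j\<in>UNIV. ?T l i j * v$i * X$j))"
    by (simp add: sum_distrib_left)
  also have "\<dots> = (\<Sum>l\<in>UNIV. (1/2) * matrix_inv G $ k $ l *
     (v$1 * ?B X (axis l 1) + X$1 * ?B v (axis l 1) - (if l = 1 then ?B v X else 0)))"
    by (simp only: ring_distribs left_diff_distrib sum.distrib sum_subtractf 1 2 3)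
  finally show ?thesis
    by (simp add: matrix_vector_mult_def sum_distrib_left mult.assoc)
qed

lemma frechet_derivative_right_invariant_field:
  "frechet_derivative (right_invariant_field X) (at 0) v = - X$1 *\<^sub>R shift v"
proof -
  have 1: "right_invariant_field X = (\<lambda>p. vector
      [X$1, X$2, X$3 - X$1 * p$2, X$4 - X$1 * p$3, X$5 - X$1 * p$4, X$6 - X$1 * p$5])"
    by (simp add: fun_eq_iff right_invariant_field_eq)
  have 2: "(\<lambda>h. - X$1 *\<^sub>R shift h) =
      (\<lambda>h. vector [0, 0, - X$1 * h$2, - X$1 * h$3, - X$1 * h$4, - X$1 * h$5])"
    by (simp add: fun_eq_iff shift_def vec_eq_iff forall_6)
  have "(right_invariant_field X has_derivative (\<lambda>h. - X$1 *\<^sub>R shift h)) (at 0)"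
    unfolding 1 2
    by (intro has_derivative_vector_6)
      (auto intro!: derivative_eq_intros has_derivative_vec_nth)
  from frechet_derivative_at[OF this, symmetric] show ?thesis by simp
qed

text \<open>
  Extend \<open>v, w\<close> to left-invariant fields.  They commute with the right-invariant field \<open>X\<^sup>*\<close>, and
  \<open>g(v, w)\<close> is constant, so that Koszul's formula reduces to
  \<open>2 g(\<nabla>\<^sub>v X\<^sup>*, w) = v (g(X\<^sup>*, w)) - w (g(X\<^sup>*, v)) - g([v, w], X\<^sup>*)\<close>.  In the left-invariant frame \<open>X\<^sup>*\<close>
  at \<open>p\<close> is \<open>Ad (p\<^sup>-\<^sup>1) X\<close>, and therefore the derivative \<open>v (g(X\<^sup>*, w))\<close> at the neutral element is
  \<open>- g([v, X], w)\<close>.  The proof checks the resulting identity in the chart.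
\<close>

lemma koszul_right_invariant_field:
  assumes G: "invertible G" and sym: "transpose G = G"
  shows "2 * (w \<bullet> (G *v levi_civita (left_invariant_metric G) v (right_invariant_field X) 0)) =
    - (h28_bracket v X \<bullet> (G *v w) + h28_bracket v w \<bullet> (G *v X) + h28_bracket X w \<bullet> (G *v v))"
proof -
  let ?B = "shift_form G"
  let ?K = "(\<chi> l. v$1 * ?B X (axis l 1) + X$1 * ?B v (axis l 1) - (if l = 1 then ?B v X else 0)) :: real^6"
  have X0: "right_invariant_field X 0 = X"
    by (simp add: right_invariant_field_eq vec_eq_iff forall_6)
  have lc: "levi_civita (left_invariant_metric G) v (right_invariant_field X) 0 =
      - X$1 *\<^sub>R shift v + (1/2) *\<^sub>R (matrix_inv G *v ?K)"
    unfolding levi_civita_def frechet_derivative_right_invariant_field X0 christoffel_contraction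
    by (simp add: vec_eq_iff)
  have GK: "G *v (matrix_inv G *v ?K) = ?K"
    by (simp add: matrix_vector_mul_assoc matrix_inv_right[OF G])
  have "w \<bullet> ?K = (\<Sum>l\<in>UNIV. v$1 * (w$l * ?B X (axis l 1)) + X$1 * (w$l * ?B v (axis l 1))
      - (if l = 1 then w$l * ?B v X else 0))"
    unfolding inner_vec_def by (intro sum.cong refl) (simp add: algebra_simps)
  also have "\<dots> = v$1 * ?B X w + X$1 * ?B v w - w$1 * ?B v X"
    by (simp add: sum.distrib sum_subtractf bilinear_expansion[OF bilinear_shift_form]
        flip: sum_distrib_left)
  finally have wK: "w \<bullet> ?K = v$1 * ?B X w + X$1 * ?B v w - w$1 * ?B v X" .
  have flip: "x \<bullet> (G *v y) = y \<bullet> (G *v x)" for x y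
    by (metis dot_lmul_matrix inner_commute sym transpose_matrix_vector)
  have E: "2 * (w \<bullet> (G *v levi_civita (left_invariant_metric G) v (right_invariant_field X) 0)) =
      - 2 * X$1 * (shift v \<bullet> (G *v w)) + w \<bullet> ?K"
    unfolding lc
    by (simp add: matrix_vector_right_distrib matrix_vector_mult_scaleR matrix_vector_mult_diff_distrib inner_diff_right GK
        flip[of w "shift v"] del: transpose_matrix_vector)
  show ?thesis
    unfolding E wK unfolding h28_bracket_shift shift_form_def
    using flip[of v "shift w"] flip[of X "shift w"] flip[of v "shift X"] flip[of X "shift v"]
    by (simp add: inner_diff_left algebra_simps)
qed


section \<open>The linear system of the distribution of symmetry\<close>

lemma symmetry_distribution_0:
  assumes G: "invertible G" and sym: "transpose G = G"
  shows "symmetry_distribution (left_invariant_metric G) 0 =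
    {Y. \<forall>X Z. h28_bracket X Y \<bullet> (G *v Z) + h28_bracket X Z \<bullet> (G *v Y) + h28_bracket Y Z \<bullet> (G *v X) = 0}"
proof -
  let ?F = "\<lambda>X Y Z. h28_bracket X Y \<bullet> (G *v Z) + h28_bracket X Z \<bullet> (G *v Y) + h28_bracket Y Z \<bullet> (G *v X)"
  let ?LC = "\<lambda>v Y. levi_civita (left_invariant_metric G) v (right_invariant_field Y) 0"
  have X0: "right_invariant_field X 0 = X" for X
    by (simp add: right_invariant_field_eq vec_eq_iff forall_6)
  have id: "frechet_derivative (\<lambda>q. h28_mult 0 q) (at 0) = (\<lambda>v::real^6. v)"
    by simp
  have "G *v u = 0 \<longleftrightarrow> u = 0" for u
    using G matrix_left_invertible_ker[of G] by (auto simp: invertible_def)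
  then have "u = 0 \<longleftrightarrow> (\<forall>w. w \<bullet> (G *v u) = 0)" for u
    by (metis inner_eq_zero_iff inner_zero_right)
  then have "?LC v Y = 0 \<longleftrightarrow> (\<forall>w. 2 * (w \<bullet> (G *v ?LC v Y)) = 0)" for v Y
    by simp
  then have "?LC v Y = 0 \<longleftrightarrow> (\<forall>w. ?F v Y w = 0)" for v Y
    by (simp only: koszul_right_invariant_field[OF G sym] neg_equal_0_iff_equal)
  then show ?thesis
    unfolding symmetry_distribution_def id
    by (simp only: X0) blast
qed

text \<open>
  The pair \<open>e\<^sub>5, e\<^sub>6\<close> isolates \<open>Y\<^sub>1\<close>: the two vectors commute, \<open>shift\<close> takes \<open>e\<^sub>5\<close> to \<open>e\<^sub>6\<close> and
  \<open>e\<^sub>6\<close> to 0, so that the condition reads \<open>Y\<^sub>1 g(e\<^sub>6, e\<^sub>6) = 0\<close>.  Once \<open>Y\<^sub>1 = 0\<close>, the condition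
  for \<open>X, Z\<close> is the one for \<open>e\<^sub>1\<close> and the vector \<open>X\<^sub>1 Z - Z\<^sub>1 X\<close> of the ideal.
\<close>

lemma symmetry_condition_iff:
  assumes sym: "transpose G = G" and pos: "G$6$6 \<noteq> 0"
  shows "(\<forall>X Z. h28_bracket X Y \<bullet> (G *v Z) + h28_bracket X Z \<bullet> (G *v Y) + h28_bracket Y Z \<bullet> (G *v X) = 0)
    \<longleftrightarrow> Y$1 = 0 \<and> (\<forall>Z. Z$1 = 0 \<longrightarrow> shift_form G Y Z = 0)"
    (is "(\<forall>X Z. ?F X Z = 0) \<longleftrightarrow> ?R")
proof -
  have flip: "x \<bullet> (G *v y) = y \<bullet> (G *v x)" for x y
    by (metis dot_lmul_matrix inner_commute sym transpose_matrix_vector)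
  have F: "?F X Z = Y$1 * (shift X \<bullet> (G *v Z) - shift Z \<bullet> (G *v X))
      + Z$1 * shift_form G Y X - X$1 * shift_form G Y Z" for X Z
    unfolding h28_bracket_shift shift_form_def
    by (simp add: inner_diff_left algebra_simps flip[of Y])
  show ?thesis
  proof
    assume *: "\<forall>X Z. ?F X Z = 0"
    have s: "shift (axis 5 1) = axis 6 1" "shift (axis 6 1) = 0"
      by (simp_all add: shift_def axis_def vec_eq_iff forall_6)
    have "?F (axis 5 1) (axis 6 1) = Y$1 * G$6$6"
      unfolding F unfolding s matrix_vector_mult_basis column_def by (simp add: axis_def inner_vec_def sum_6)
    with * pos have Y1: "Y$1 = 0" by (metis mult_eq_0_iff)
    have "shift_form G Y Z = 0" if "Z$1 = 0" for Z
      using *[rule_format, of "axis 1 1" Z] that unfolding F Y1 by (simp add: axis_def)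
    with Y1 show ?R by simp
  next
    assume ?R
    have "linear (shift_form G Y)"
      using bilinear_shift_form by (simp add: bilinear_def)
    then have "Z$1 * shift_form G Y X - X$1 * shift_form G Y Z = shift_form G Y (Z$1 *\<^sub>R X - X$1 *\<^sub>R Z)" for X Z
      by (simp add: linear_diff linear_cmul)
    with \<open>?R\<close> show "\<forall>X Z. ?F X Z = 0"
      by (simp add: F)
  qed
qed


section \<open>Elimination down to a three by three matrix\<close>

lemma triangular_mult:
  fixes s0 s1 s2 s3 s4 s5 s6 s7 s8 s9 :: real
  shows "(vector [
           vector [1, 0,  0,  0,  0,  0],
           vector [0, 1,  0,  0,  0,  0],
           vector [0, 0, s0,  0,  0,  0],
           vector [0, 0, s1, s2,  0,  0],
           vector [0, 0, s3, s4, s5,  0],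
           vector [0, 0, s6, s7, s8, s9]] :: real^6^6) *v (y :: real^6) =
    vector [y$1, y$2, s0 * y$3, s1 * y$3 + s2 * y$4, s3 * y$3 + s4 * y$4 + s5 * y$5,
      s6 * y$3 + s7 * y$4 + s8 * y$5 + s9 * y$6]"
  by (simp add: matrix_vector_mult_def vec_eq_iff forall_6 sum_6)

lemma bilinear_zero_on_ideal_iff:
  fixes f :: "real^6 \<Rightarrow> real^6 \<Rightarrow> real"
  assumes "bilinear f"
  shows "(\<forall>Z. Z$1 = 0 \<longrightarrow> f Y Z = 0) \<longleftrightarrow> (\<forall>j. j \<noteq> 1 \<longrightarrow> f Y (axis j 1) = 0)"
proof (intro iffI allI impI)
  fix j :: 6
  assume "\<forall>Z. Z$1 = 0 \<longrightarrow> f Y Z = 0" and "j \<noteq> 1"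
  then show "f Y (axis j 1) = 0" by (simp add: axis_def)
next
  fix Z :: "real^6"
  assume "\<forall>j. j \<noteq> 1 \<longrightarrow> f Y (axis j 1) = 0" and "Z$1 = 0"
  then have "(\<Sum>j\<in>UNIV. Z$j * f Y (axis j 1)) = 0"
    by (intro sum.neutral) (metis mult_eq_0_iff)
  then show "f Y Z = 0"
    by (simp only: bilinear_expansion[OF assms])
qed

text \<open>
  Writing the form as \<open>\<sigma> shift Y \<bullet> \<sigma> Z + \<sigma> Y \<bullet> \<sigma> shift Z\<close> keeps the triangular shape of \<open>\<sigma>\<close> visible:
  the equation for \<open>e\<^sub>6\<close> is \<open>s\<^sub>9 p\<^sub>6 = 0\<close>, and modulo it the equation for \<open>e\<^sub>5\<close> is
  \<open>s\<^sub>5 p\<^sub>5 + s\<^sub>9 u\<^sub>6 = 0\<close>.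
\<close>

lemma kernel_equations:
  fixes s0 s1 s2 s3 s4 s5 s6 s7 s8 s9 a b c \<alpha> \<beta> \<gamma> :: real
    and \<sigma> :: "real^6^6" and A :: "real^3^3"
  assumes s9: "s9 \<noteq> 0"
    and \<sigma>: "\<sigma> = vector [
           vector [1, 0,  0,  0,  0,  0],
           vector [0, 1,  0,  0,  0,  0],
           vector [0, 0, s0,  0,  0,  0],
           vector [0, 0, s1, s2,  0,  0],
           vector [0, 0, s3, s4, s5,  0],
           vector [0, 0, s6, s7, s8, s9]]"
    and coeffs: "a = s5^2 * s6 + s3 * s5 * s8 - (s1 * s2 + s3 * s4) * s9"
      "b = s5^2 * s7 + s4 * s5 * s8 - (s2^2 + s4^2 + s3 * s5) * s9"
      "c = s4 * s5 * s6 + s3 * s5 * s7 - (s0^2 + s1^2 + s3^2) * s9"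
      "\<alpha> = 2 * s5^2 * s8 - 2 * s4 * s5 * s9"
      "\<beta> = 2 * s4 * s5 * s7 - 2 * (s1 * s2 + s3 * s4) * s9"
      "\<gamma> = 2 * s3 * s5 * s6"
    and A: "A = vector [vector [a, b, \<alpha>], vector [c, \<beta>, b], vector [\<gamma>, c, a]]"
    and Y1: "Y$1 = 0"
  defines "p \<equiv> \<sigma> *v shift Y" and "u \<equiv> \<sigma> *v Y"
  shows "(\<forall>Z. Z$1 = 0 \<longrightarrow> shift_form (transpose \<sigma> ** \<sigma>) Y Z = 0) \<longleftrightarrow>
    p$6 = 0 \<and> s5 * p$5 + s9 * u$6 = 0 \<and> A *v vector [Y$2, Y$3, Y$4] = 0"
proof -
  let ?e = "\<lambda>j. shift_form (transpose \<sigma> ** \<sigma>) Y (axis j 1)"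
  have e: "?e j = p \<bullet> (\<sigma> *v axis j 1) + u \<bullet> (\<sigma> *v shift (axis j 1))" for j
    by (simp add: shift_form_def gram_inner p_def u_def)
  have E: "?e 2 = s0 * u$3 + s1 * u$4 + s3 * u$5 + s6 * u$6"
    "?e 3 = s0 * p$3 + s1 * p$4 + s3 * p$5 + s6 * p$6 + s2 * u$4 + s4 * u$5 + s7 * u$6"
    "?e 4 = s2 * p$4 + s4 * p$5 + s7 * p$6 + s5 * u$5 + s8 * u$6"
    "?e 5 = s5 * p$5 + s8 * p$6 + s9 * u$6"
    "?e 6 = s9 * p$6"
    unfolding e
    by (simp_all add: \<sigma> triangular_mult inner_vec_def sum_6 axis_def shift_def p_def)
  have p: "p$3 = s0 * Y$2" "p$4 = s1 * Y$2 + s2 * Y$3" "p$5 = s3 * Y$2 + s4 * Y$3 + s5 * Y$4"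
    "p$6 = s6 * Y$2 + s7 * Y$3 + s8 * Y$4 + s9 * Y$5"
    by (simp_all add: p_def \<sigma> triangular_mult shift_def)
  have u: "u$3 = s0 * Y$3" "u$4 = s1 * Y$3 + s2 * Y$4" "u$5 = s3 * Y$3 + s4 * Y$4 + s5 * Y$5"
    "u$6 = s6 * Y$3 + s7 * Y$4 + s8 * Y$5 + s9 * Y$6"
    by (simp_all add: u_def \<sigma> triangular_mult)
  have Az: "(A *v vector [Y$2, Y$3, Y$4])$1 = a * Y$2 + b * Y$3 + \<alpha> * Y$4"
    "(A *v vector [Y$2, Y$3, Y$4])$2 = c * Y$2 + \<beta> * Y$3 + b * Y$4"
    "(A *v vector [Y$2, Y$3, Y$4])$3 = \<gamma> * Y$2 + c * Y$3 + a * Y$4"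
    by (simp_all add: A matrix_vector_mult_def sum_3)
  \<comment> \<open>The multiples of the equations for \<open>e\<^sub>5\<close> and \<open>e\<^sub>6\<close> are chosen so as to cancel \<open>Y\<^sub>6\<close> and \<open>Y\<^sub>5\<close>.\<close>
  have R2: "s9 * ?e 2 = s6 * ?e 5 + (s3 * s5 - s6 * s8) * p$6 - (A *v vector [Y$2, Y$3, Y$4])$3"
    unfolding E Az coeffs unfolding p u by algebra
  have R3: "s9 * ?e 3 = s7 * ?e 5 + (s6 * s9 + s4 * s5 - s7 * s8) * p$6
      - (A *v vector [Y$2, Y$3, Y$4])$2"
    unfolding E Az coeffs unfolding p u by algebra
  have R4: "s9 * ?e 4 = s8 * ?e 5 + (s7 * s9 + s5^2 - s8^2) * p$6 - (A *v vector [Y$2, Y$3, Y$4])$1"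
    unfolding E Az coeffs unfolding p u by algebra
  have "(\<forall>Z. Z$1 = 0 \<longrightarrow> shift_form (transpose \<sigma> ** \<sigma>) Y Z = 0) \<longleftrightarrow>
      ?e 2 = 0 \<and> ?e 3 = 0 \<and> ?e 4 = 0 \<and> ?e 5 = 0 \<and> ?e 6 = 0"
    unfolding bilinear_zero_on_ideal_iff[OF bilinear_shift_form] forall_6 by simp
  also have "\<dots> \<longleftrightarrow> ?e 6 = 0 \<and> ?e 5 = 0 \<and> s9 * ?e 4 = 0 \<and> s9 * ?e 3 = 0 \<and> s9 * ?e 2 = 0"
    using s9 by auto
  also have "\<dots> \<longleftrightarrow> p$6 = 0 \<and> s5 * p$5 + s9 * u$6 = 0 \<and> A *v vector [Y$2, Y$3, Y$4] = 0"
    unfolding R2 R3 R4 using s9 by (auto simp: E(4,5) vec_eq_iff forall_3)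
  finally show ?thesis .
qed

section \<open>The index of symmetry\<close>

theorem theorem6p7:
  fixes s0 s1 s2 s3 s4 s5 s6 s7 s8 s9 a b c \<alpha> \<beta> \<gamma> :: real
    and \<sigma> :: "real^6^6" and A :: "real^3^3"
  assumes "s0 > 0" and "s2 > 0" and "s5 > 0" and "s9 > 0"
    and "\<sigma> = vector [
           vector [1, 0,  0,  0,  0,  0],
           vector [0, 1,  0,  0,  0,  0],
           vector [0, 0, s0,  0,  0,  0],
           vector [0, 0, s1, s2,  0,  0],
           vector [0, 0, s3, s4, s5,  0],
           vector [0, 0, s6, s7, s8, s9]]"
    and "a = s5^2 * s6 + s3 * s5 * s8 - (s1 * s2 + s3 * s4) * s9"
    and "b = s5^2 * s7 + s4 * s5 * s8 - (s2^2 + s4^2 + s3 * s5) * s9"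
    and "c = s4 * s5 * s6 + s3 * s5 * s7 - (s0^2 + s1^2 + s3^2) * s9"
    and "\<alpha> = 2 * s5^2 * s8 - 2 * s4 * s5 * s9"
    and "\<beta> = 2 * s4 * s5 * s7 - 2 * (s1 * s2 + s3 * s4) * s9"
    and "\<gamma> = 2 * s3 * s5 * s6"
    and "A = vector [vector [a, b, \<alpha>], vector [c, \<beta>, b], vector [\<gamma>, c, a]]"
  shows "int (index_of_symmetry (left_invariant_metric (transpose \<sigma> ** \<sigma>))) = 3 - int (rank A)"
proof -
  let ?G = "transpose \<sigma> ** \<sigma>"
  note \<sigma> = assms(5)
  have "x = 0" if "\<sigma> *v x = 0" for x
    using that assms(1-4) by (auto simp: \<sigma> triangular_mult vec_eq_iff forall_6)
  then have G: "invertible ?G"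
    by (rule invertible_gram)
  have sym: "transpose ?G = ?G"
    by (simp add: matrix_transpose_mul)
  have G66: "?G$6$6 \<noteq> 0"
    using assms(4) by (simp add: \<sigma> matrix_matrix_mult_def transpose_def sum_6)
  \<comment> \<open>The solutions of the equations for \<open>e\<^sub>6\<close> and \<open>e\<^sub>5\<close> in terms of \<open>z = (Y\<^sub>2, Y\<^sub>3, Y\<^sub>4)\<close>.\<close>
  define y5 where "y5 z = - (s6 * z$1 + s7 * z$2 + s8 * z$3) / s9" for z :: "real^3"
  define y6 where "y6 z = - (s5 * (s3 * z$1 + s4 * z$2 + s5 * z$3) / s9
      + (s6 * z$2 + s7 * z$3 + s8 * y5 z)) / s9" for z :: "real^3"
  define \<phi> :: "real^3 \<Rightarrow> real^6" where "\<phi> z = vector [0, z$1, z$2, z$3, y5 z, y6 z]" for z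
  have "linear \<phi>"
    by (rule linearI)
      (use assms(4) in \<open>simp_all add: \<phi>_def y5_def y6_def vec_eq_iff forall_6 field_simps\<close>)
  moreover have "inj \<phi>"
    by (rule injI) (simp add: \<phi>_def vec_eq_iff forall_6 forall_3)
  ultimately have dim: "dim (\<phi> ` {z. A *v z = 0}) = dim {z. A *v z = 0}"
    by (metis dim_image_eq inj_on_subset subset_UNIV)
  have mem: "Y \<in> symmetry_distribution (left_invariant_metric ?G) 0 \<longleftrightarrow>
      Y$1 = 0 \<and> Y$5 = y5 (vector [Y$2, Y$3, Y$4]) \<and> Y$6 = y6 (vector [Y$2, Y$3, Y$4]) \<and>
      A *v vector [Y$2, Y$3, Y$4] = 0" for Y
  proof (cases "Y$1 = 0")
    case True
    let ?z = "vector [Y$2, Y$3, Y$4] :: real^3"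
    have Y5: "(\<sigma> *v shift Y)$6 = 0 \<longleftrightarrow> Y$5 = y5 ?z"
      using assms(4) by (simp add: \<sigma> triangular_mult shift_def y5_def field_simps) argo
    have Y6: "s5 * (\<sigma> *v shift Y)$5 + s9 * (\<sigma> *v Y)$6 = 0 \<longleftrightarrow> Y$6 = y6 ?z" if "Y$5 = y5 ?z"
      using assms(4) by (simp add: \<sigma> triangular_mult shift_def y6_def that[symmetric] field_simps) argo
    show ?thesis
      using assms(4) Y5 Y6 True
      unfolding symmetry_distribution_0[OF G sym] mem_Collect_eq symmetry_condition_iff[OF sym G66]
      by (subst kernel_equations[OF _ \<sigma> assms(6-12)]) auto
  next
    case False
    then show ?thesis
      unfolding symmetry_distribution_0[OF G sym] mem_Collect_eq symmetry_condition_iff[OF sym G66]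
      by simp
  qed
  have "symmetry_distribution (left_invariant_metric ?G) 0 = \<phi> ` {z. A *v z = 0}"
  proof (intro set_eqI iffI)
    fix Y
    assume "Y \<in> symmetry_distribution (left_invariant_metric ?G) 0"
    then show "Y \<in> \<phi> ` {z. A *v z = 0}"
      unfolding mem
      by (intro image_eqI[of _ _ "vector [Y$2, Y$3, Y$4]"]) (auto simp: \<phi>_def vec_eq_iff forall_6)
  next
    fix Y
    assume "Y \<in> \<phi> ` {z. A *v z = 0}"
    then obtain z where "A *v z = 0" and Y: "Y = \<phi> z" by blast
    moreover have "vector [Y$2, Y$3, Y$4] = z"
      by (simp add: Y \<phi>_def vec_eq_iff forall_3)
    ultimately show "Y \<in> symmetry_distribution (left_invariant_metric ?G) 0"
      unfolding mem by (simp add: \<phi>_def)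
  qed
  then have "index_of_symmetry (left_invariant_metric ?G) = dim {z. A *v z = 0}"
    by (simp add: index_of_symmetry_def dim)
  then show ?thesis
    using dim_kernel_plus_rank[of A] by simp
qed

end
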